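(* Let $b$ be a non-negative rational number with $b\neq 0$, and let $f^*:\{0,1\}^4\to\mathbb{Q}_{\ge 0}$ be the constraint function given by $f^*(0,0,1,1)=1$, $f^*(0,1,1,0)=f^*(1,0,0,1)=b$, and $f^*(x)=0$ for every other $x\in\{0,1\}^4$. Then $f^*$ is unwindable, i.e. $f^*$ is not windable.
   Context: For a finite set $J$ and $x\in\{0,1\}^J$, let $\mathcal{M}_x$ be the set of partitions of $\{i\in J: x_i=1\}$ into pairs and at most one singleton. Let $x\oplus y$ denote the coordinatewise sum mod 2, and for a set $S\subseteq J$ let $x\oplus S$ denote the vector obtained from $x$ by changing $x_i$ to $1-x_i$ for each $i\in S$. A function $f:\{0,1\}^J\to\mathbb{Q}_{\ge 0}$ is called windable if there exist values $B(x,y,M)\ge 0$ for all $x,y\in\{0,1\}^J$ and all $M\in\mathcal{M}_{x\oplus y}$ such that: (1) $f(x)f(y)=\sum_{M\in\mathcal{M}_{x\oplus y}}B(x,y,M)$ for all $x,y\in\{0,1\}^J$; (2) $B(x,y,M)=B(x\oplus S,\,y\oplus S,\,M)$ for all $x,y\in\{0,1\}^J$ and all $S\in M\in\mathcal{M}_{x\oplus y}$. Here $J=\{1,2,3,4\}$. *)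

theory Defs
  imports Complex_Main "HOL-Library.FuncSet" "HOL-Library.Disjoint_Sets"
begin

(* The index set J is meant to be finite throughout. Elements of {0,1}^J are the
   extensional functions on J, so that equality of vectors is equality on J. *)
definition cube :: "'i set \<Rightarrow> ('i \<Rightarrow> nat) set" where
  "cube J = J \<rightarrow>\<^sub>E {0, 1}"

definition vec_xor :: "'i set \<Rightarrow> ('i \<Rightarrow> nat) \<Rightarrow> ('i \<Rightarrow> nat) \<Rightarrow> 'i \<Rightarrow> nat" where
  "vec_xor J x y = (\<lambda>i\<in>J. (x i + y i) mod 2)"

definition vec_flip :: "'i set \<Rightarrow> ('i \<Rightarrow> nat) \<Rightarrow> 'i set \<Rightarrow> 'i \<Rightarrow> nat" where
  "vec_flip J x S = (\<lambda>i\<in>J. if i \<in> S then 1 - x i else x i)"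

definition pairings :: "'i set \<Rightarrow> ('i \<Rightarrow> nat) \<Rightarrow> 'i set set set" where
  "pairings J x = {M. partition_on {i \<in> J. x i = 1} M
      \<and> (\<forall>S\<in>M. card S = 2 \<or> card S = 1)
      \<and> card {S \<in> M. card S = 1} \<le> 1}"

(* Only the restriction of f to cube J matters. The values B x y M are real numbers, so
   non-windability rules out real (hence also rational) witnesses. Nonnegativity of f is
   not part of the predicate: it is a property of the functions it is applied to. *)
definition windable :: "'i set \<Rightarrow> (('i \<Rightarrow> nat) \<Rightarrow> rat) \<Rightarrow> bool" where
  "windable J f \<longleftrightarrow>
    (\<exists>B :: ('i \<Rightarrow> nat) \<Rightarrow> ('i \<Rightarrow> nat) \<Rightarrow> 'i set set \<Rightarrow> real.
      (\<forall>x\<in>cube J. \<forall>y\<in>cube J. \<forall>M\<in>pairings J (vec_xor J x y). 0 \<le> B x y M)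
    \<and> (\<forall>x\<in>cube J. \<forall>y\<in>cube J.
         of_rat (f x) * of_rat (f y) = (\<Sum>M\<in>pairings J (vec_xor J x y). B x y M))
    \<and> (\<forall>x\<in>cube J. \<forall>y\<in>cube J. \<forall>M\<in>pairings J (vec_xor J x y). \<forall>S\<in>M.
         B x y M = B (vec_flip J x S) (vec_flip J y S) M))"

definition f_star :: "rat \<Rightarrow> (nat \<Rightarrow> nat) \<Rightarrow> rat" where
  "f_star b x =
    (if (x 1, x 2, x 3, x 4) = (0, 0, 1, 1) then 1
     else if (x 1, x 2, x 3, x 4) = (0, 1, 1, 0) \<or> (x 1, x 2, x 3, x 4) = (1, 0, 0, 1) then b
     else 0)"

lemma f_star_nonneg: "0 \<le> b \<Longrightarrow> 0 \<le> f_star b x"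
  by (simp add: f_star_def)

(* The right-hand side of the flip condition in windable stays in the domain of B. *)

lemma vec_flip_in_cube: "x \<in> cube J \<Longrightarrow> vec_flip J x S \<in> cube J"
  by (fastforce simp: cube_def vec_flip_def PiE_iff)

lemma vec_xor_flip:
  assumes "x \<in> cube J" "y \<in> cube J"
  shows "vec_xor J (vec_flip J x S) (vec_flip J y S) = vec_xor J x y"
proof
  fix i
  show "vec_xor J (vec_flip J x S) (vec_flip J y S) i = vec_xor J x y i"
  proof (cases "i \<in> J")
    case True
    then have "x i \<in> {0, 1}" "y i \<in> {0, 1}"
      using assms by (auto simp: cube_def PiE_iff)
    with True show ?thesis
      by (auto simp: vec_xor_def vec_flip_def)
  qed (simp add: vec_xor_def)
qed

lemma finite_pairings: "finite J \<Longrightarrow> finite (pairings J x)"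
  by (rule finite_subset[of _ "Pow (Pow J)"]) (auto simp: pairings_def partition_on_def)

end

theory Submission
  imports Defs
begin

text \<open>With \<open>x = (0,1,1,0)\<close> and \<open>y = (1,0,0,1)\<close> the product \<open>f x * f y = b\<^sup>2\<close> is nonzero, so some
  pairing \<open>M\<close> of all four coordinates has \<open>B x y M > 0\<close>, and then \<open>f\<close> is nonzero at \<open>x \<oplus> S\<close>
  for each block \<open>S\<close> of \<open>M\<close>. But the only point of the support with first coordinate \<open>1\<close> is
  \<open>y\<close>, so the block containing \<open>1\<close> would have to flip all four coordinates.\<close>

lemma windable_nonzero_flip:
  assumes "windable J f" and "finite J" and x: "x \<in> cube J" and y: "y \<in> cube J"
    and nz: "f x * f y \<noteq> 0"
  obtains M where "M \<in> pairings J (vec_xor J x y)"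
    and "\<And>S. S \<in> M \<Longrightarrow> f (vec_flip J x S) * f (vec_flip J y S) \<noteq> 0"
proof -
  obtain B :: "('a \<Rightarrow> nat) \<Rightarrow> ('a \<Rightarrow> nat) \<Rightarrow> 'a set set \<Rightarrow> real" where
    nonneg [rule_format]:
      "\<forall>x\<in>cube J. \<forall>y\<in>cube J. \<forall>M\<in>pairings J (vec_xor J x y). 0 \<le> B x y M"
    and total [rule_format]: "\<forall>x\<in>cube J. \<forall>y\<in>cube J.
      of_rat (f x) * of_rat (f y) = (\<Sum>M\<in>pairings J (vec_xor J x y). B x y M)"
    and flip [rule_format]: "\<forall>x\<in>cube J. \<forall>y\<in>cube J. \<forall>M\<in>pairings J (vec_xor J x y). \<forall>S\<in>M.
      B x y M = B (vec_flip J x S) (vec_flip J y S) M"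
    using assms(1) unfolding windable_def by (elim exE conjE)
  have "(\<Sum>M\<in>pairings J (vec_xor J x y). B x y M) \<noteq> 0"
    using total[OF x y] nz by auto
  then obtain M where M: "M \<in> pairings J (vec_xor J x y)" and BM: "B x y M \<noteq> 0"
    by (meson sum.neutral)
  show thesis
  proof (rule that[OF M])
    fix S assume S: "S \<in> M"
    let ?x = "vec_flip J x S" and ?y = "vec_flip J y S"
    have cube: "?x \<in> cube J" "?y \<in> cube J"
      using x y by (auto intro: vec_flip_in_cube)
    have xor: "vec_xor J ?x ?y = vec_xor J x y"
      using x y by (rule vec_xor_flip)
    show "f ?x * f ?y \<noteq> 0"
    proof
      assume "f ?x * f ?y = 0"
      then have "(\<Sum>M\<in>pairings J (vec_xor J x y). B ?x ?y M) = 0"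
        using total[OF cube] xor by auto
      \<comment> \<open>Flipping both vectors along \<open>S\<close> leaves their xor unchanged, so
        \<open>M\<close> also indexes this sum; its terms are nonnegative, so a zero total makes
        each of them vanish.\<close>
      then have "B ?x ?y M = 0"
        using M nonneg[OF cube] finite_pairings[OF assms(2)]
        by (simp add: xor sum_nonneg_eq_0_iff)
      with flip[OF x y M S] BM show False by simp
    qed
  qed
qed

theorem lemma2:
  fixes b :: rat
  assumes "0 \<le> b" and "b \<noteq> 0"
  shows "\<not> windable {1, 2, 3, 4 :: nat} (f_star b)"
proof
  let ?J = "{1, 2, 3, 4 :: nat}"
  assume windable: "windable ?J (f_star b)"
  define x :: "nat \<Rightarrow> nat" where "x = (\<lambda>i\<in>?J. if i = 2 \<or> i = 3 then 1 else 0)"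
  define y :: "nat \<Rightarrow> nat" where "y = (\<lambda>i\<in>?J. if i = 1 \<or> i = 4 then 1 else 0)"
  have "x \<in> cube ?J" "y \<in> cube ?J"
    by (auto simp: x_def y_def cube_def)
  moreover have "f_star b x * f_star b y \<noteq> 0"
    using assms by (simp add: f_star_def x_def y_def)
  ultimately obtain M where M: "M \<in> pairings ?J (vec_xor ?J x y)"
    and nz: "\<And>S. S \<in> M \<Longrightarrow> f_star b (vec_flip ?J x S) * f_star b (vec_flip ?J y S) \<noteq> 0"
    using windable_nonzero_flip[OF windable, of x y] by (metis finite.emptyI finite.insertI)
  \<comment> \<open>\<open>x\<close> and \<open>y\<close> are complementary, so \<open>M\<close>
    partitions all four coordinates.\<close>
  have "1 \<in> \<Union>M"
    using M by (auto simp: pairings_def partition_on_def vec_xor_def x_def y_def)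
  then obtain S where S: "S \<in> M" "1 \<in> S" by blast
  then have "f_star b (vec_flip ?J x S) \<noteq> 0"
    using nz by fastforce
  \<comment> \<open>Flipping 1 forces the support point (1,0,0,1), so the ones of \<open>x\<close>
    at 2 and 3 must flip too. Coordinate 4 is left out: three elements already exceed the block
    size.\<close>
  then have "{1, 2, 3} \<subseteq> S"
    using S(2) by (auto simp: f_star_def vec_flip_def x_def split: if_splits)
  moreover have cardS: "card S = 1 \<or> card S = 2"
    using M S(1) by (auto simp: pairings_def)
  \<comment> \<open>An infinite set has \<open>card\<close> 0, which \<open>cardS\<close>
    excludes.\<close>
  then have "finite S" by (metis card.infinite zero_neq_one zero_neq_numeral)
  ultimately have "card {1, 2, 3 :: nat} \<le> card S"
    by (intro card_mono)
  with cardS show False by simp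
qed

end
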